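(* Let $\Delta$ be a numerical semigroup. (1) For every integer $k\ge\operatorname{e}(\Delta)$ there exist an integer $d\ge1$ and a numerical semigroup $S$ such that $S/d=\Delta$ and $\operatorname{e}(S)=k$. More precisely, one may take $d=k-(\operatorname{e}(\Delta)-1)$. (2) Let $e_{\min}=\min\{\operatorname{e}(T): T\text{ is a multiple of }\Delta\}$. Then every integer $k\ge e_{\min}$ occurs as the embedding dimension of some multiple of $\Delta$.
   Context: $\mathbb{N}=\{0,1,2,\dots\}$. A numerical semigroup is a submonoid of $(\mathbb{N},+)$ with finite complement in $\mathbb{N}$; each numerical semigroup $S$ has a unique minimal system of generators, whose cardinality is the embedding dimension $\operatorname{e}(S)$. For $A\subseteq\mathbb{N}$ and $d\ge1$, $A/d=\{x\in\mathbb{N}: dx\in A\}$. A numerical semigroup $T$ is a multiple of a numerical semigroup $\Delta$ if $T/d=\Delta$ for some integer $d\ge1$. *)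

theory Defs
  imports Main "HOL.Hull"
begin

definition nat_submonoid :: "nat set \<Rightarrow> bool" where
  "nat_submonoid S \<longleftrightarrow> 0 \<in> S \<and> (\<forall>x\<in>S. \<forall>y\<in>S. x + y \<in> S)"

definition numerical_semigroup :: "nat set \<Rightarrow> bool" where
  "numerical_semigroup S \<longleftrightarrow> nat_submonoid S \<and> finite (- S)"

text \<open>The submonoid generated by \<open>A\<close> is \<open>nat_submonoid hull A\<close>, the intersection of
  all submonoids containing \<open>A\<close>.\<close>

definition minimal_generators :: "nat set \<Rightarrow> nat set \<Rightarrow> bool" where
  "minimal_generators S A \<longleftrightarrow>
     nat_submonoid hull A = S \<and> (\<forall>B. B \<subset> A \<longrightarrow> nat_submonoid hull B \<noteq> S)"

text \<open>The description operator and \<open>card\<close> are meaningful for numerical semigroups by the lemmas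
  \<open>ex1_minimal_generators\<close> and \<open>finite_minimal_generators\<close> below.\<close>

definition embedding_dim :: "nat set \<Rightarrow> nat" where
  "embedding_dim S = card (THE A. minimal_generators S A)"

definition set_quotient :: "nat set \<Rightarrow> nat \<Rightarrow> nat set" where
  "set_quotient A d = {x. d * x \<in> A}"

definition is_multiple_of :: "nat set \<Rightarrow> nat set \<Rightarrow> bool" where
  "is_multiple_of T \<Delta> \<longleftrightarrow>
     numerical_semigroup T \<and> numerical_semigroup \<Delta> \<and> (\<exists>d\<ge>1. set_quotient T d = \<Delta>)"

definition min_embedding_dim_multiples :: "nat set \<Rightarrow> nat" where
  "min_embedding_dim_multiples \<Delta> = (LEAST e. \<exists>T. is_multiple_of T \<Delta> \<and> e = embedding_dim T)"

definition atoms :: "nat set \<Rightarrow> nat set" where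
  "atoms S = {x\<in>S. x \<noteq> 0 \<and> \<not> (\<exists>a\<in>S. \<exists>b\<in>S. a \<noteq> 0 \<and> b \<noteq> 0 \<and> x = a + b)}"

lemma nat_submonoid_hull: "nat_submonoid (nat_submonoid hull A)"
  by (rule hull_in) (auto simp: nat_submonoid_def)

lemma atoms_subset_generators:
  assumes "nat_submonoid hull A = S"
  shows "atoms S \<subseteq> A"
proof
  fix x assume x: "x \<in> atoms S"
  have S: "nat_submonoid S" using nat_submonoid_hull[of A] assms by simp
  show "x \<in> A"
  proof (rule ccontr)
    assume "x \<notin> A"
    have "A \<subseteq> S" using assms hull_subset[of A nat_submonoid] by simp
    have "nat_submonoid (S - {x})"
      unfolding nat_submonoid_def
    proof (intro conjI ballI)
      show "0 \<in> S - {x}" using S x by (auto simp: nat_submonoid_def atoms_def)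
    next
      fix a b assume ab: "a \<in> S - {x}" "b \<in> S - {x}"
      then have "a + b \<in> S" using S by (auto simp: nat_submonoid_def)
      moreover have "a + b \<noteq> x"
      proof
        assume e: "a + b = x"
        then have "a \<noteq> 0" "b \<noteq> 0" using ab by auto
        then show False using x ab e by (auto simp: atoms_def)
      qed
      ultimately show "a + b \<in> S - {x}" by simp
    qed
    then have "nat_submonoid hull A \<subseteq> S - {x}"
      using \<open>A \<subseteq> S\<close> \<open>x \<notin> A\<close> by (intro hull_minimal) auto
    then show False using assms x by (auto simp: atoms_def)
  qed
qed

lemma hull_atoms:
  assumes S: "nat_submonoid S"
  shows "nat_submonoid hull (atoms S) = S"
proof
  show "nat_submonoid hull (atoms S) \<subseteq> S"
    using S by (intro hull_minimal) (auto simp: atoms_def)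
  define H where "H = nat_submonoid hull (atoms S)"
  have "nat_submonoid H" unfolding H_def by (rule nat_submonoid_hull)
  then have H0: "0 \<in> H" and Hadd: "\<And>a b. a \<in> H \<Longrightarrow> b \<in> H \<Longrightarrow> a + b \<in> H"
    by (auto simp: nat_submonoid_def)
  have "x \<in> S \<Longrightarrow> x \<in> H" for x
  proof (induction x rule: less_induct)
    case (less x)
    consider "x = 0" | "x \<in> atoms S" | a b where "a \<in> S" "b \<in> S" "a \<noteq> 0" "b \<noteq> 0" "x = a + b"
      using less.prems by (auto simp: atoms_def)
    then show ?case
    proof cases
      case 1
      then show ?thesis using H0 by simp
    next
      case 2
      then show ?thesis unfolding H_def by (rule hull_inc)
    next
      case 3
      then show ?thesis using less.IH[of a] less.IH[of b] Hadd by simp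
    qed
  qed
  then show "S \<subseteq> nat_submonoid hull (atoms S)" unfolding H_def by blast
qed

lemma minimal_generators_iff_atoms:
  assumes "nat_submonoid S"
  shows "minimal_generators S A \<longleftrightarrow> A = atoms S"
proof
  assume A: "minimal_generators S A"
  then have "atoms S \<subseteq> A"
    by (intro atoms_subset_generators) (simp add: minimal_generators_def)
  moreover have "\<not> atoms S \<subset> A"
    using A hull_atoms[OF assms] unfolding minimal_generators_def by meson
  ultimately show "A = atoms S" by auto
next
  assume A: "A = atoms S"
  show "minimal_generators S A"
    unfolding minimal_generators_def A
  proof (intro conjI allI impI notI)
    show "nat_submonoid hull atoms S = S" by (rule hull_atoms[OF assms])
  next
    fix B assume "B \<subset> atoms S" "nat_submonoid hull B = S"
    from \<open>nat_submonoid hull B = S\<close> have "atoms S \<subseteq> B" by (rule atoms_subset_generators)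
    with \<open>B \<subset> atoms S\<close> show False by (meson psubset_subset_trans order_less_irrefl)
  qed
qed

lemma ex1_minimal_generators:
  assumes "numerical_semigroup S"
  shows "\<exists>!A. minimal_generators S A"
proof -
  have "nat_submonoid S" using assms by (simp add: numerical_semigroup_def)
  from minimal_generators_iff_atoms[OF this] show ?thesis by simp
qed

lemma finite_minimal_generators:
  assumes "numerical_semigroup S" "minimal_generators S A"
  shows "finite A"
proof -
  have S: "nat_submonoid S" and f: "finite (- S)"
    using assms by (auto simp: numerical_semigroup_def)
  from f obtain c where c: "\<And>x. x \<notin> S \<Longrightarrow> x < c"
    using finite_nat_set_iff_bounded by auto
  have "atoms S \<subseteq> {..< 2 * c + 2}"
  proof
    fix x assume x: "x \<in> atoms S"
    show "x \<in> {..< 2 * c + 2}"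
    proof (rule ccontr)
      assume "x \<notin> {..< 2 * c + 2}"
      then obtain y where y: "x = (c + 1) + y" "c + 1 \<le> y"
        using that[of "x - (c + 1)"] by simp
      have "c + 1 \<in> S" "y \<in> S" using c[of "c + 1"] c[of y] y(2) by fastforce+
      then have "\<exists>a\<in>S. \<exists>b\<in>S. a \<noteq> 0 \<and> b \<noteq> 0 \<and> x = a + b"
        using y by (intro bexI[of _ "c + 1"] bexI[of _ y]) auto
      then show False using x unfolding atoms_def by blast
    qed
  qed
  then show ?thesis
    using assms(2) finite_subset[OF _ finite_lessThan]
    unfolding minimal_generators_iff_atoms[OF S] by simp
qed

end

(* Let N exceed every gap and every minimal generator of \<Delta>. Adjoining the d - 1 numbers d * N + r
   with 0 < r < d to d * \<Delta> gives a multiple of \<Delta>: sums of two new generators are so large that they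
   create no new multiples of d, and all residues modulo d being present makes the complement finite.
   None of the generators becomes redundant, so the embedding dimension grows by exactly d - 1.
   The second claim follows by applying this to a multiple of \<Delta> of least embedding dimension. *)
theory Submission
  imports Defs
begin

section \<open>Embedding dimension as the number of atoms\<close>

lemma numerical_semigroup_zero: "numerical_semigroup S \<Longrightarrow> 0 \<in> S"
  and numerical_semigroup_add:
    "numerical_semigroup S \<Longrightarrow> x \<in> S \<Longrightarrow> y \<in> S \<Longrightarrow> x + y \<in> S"
  by (auto simp: numerical_semigroup_def nat_submonoid_def)

lemma embedding_dim_eq_card_atoms:
  assumes "numerical_semigroup S"
  shows "embedding_dim S = card (atoms S)"
proof -
  have "nat_submonoid S" using assms by (simp add: numerical_semigroup_def)
  then show ?thesis
    by (simp add: embedding_dim_def minimal_generators_iff_atoms)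
qed

lemma finite_atoms:
  assumes "numerical_semigroup S"
  shows "finite (atoms S)"
proof -
  have "nat_submonoid S" using assms by (simp add: numerical_semigroup_def)
  then show ?thesis
    using finite_minimal_generators[OF assms] by (simp add: minimal_generators_iff_atoms)
qed

text \<open>Without atoms the semigroup would be \<open>{0}\<close>, whose complement is infinite.
  Positivity is what makes the truncated subtractions in \<open>k - (embedding_dim T - 1)\<close>
  exact.\<close>

lemma embedding_dim_pos:
  assumes "numerical_semigroup S"
  shows "embedding_dim S > 0"
proof -
  have S: "nat_submonoid S" "finite (- S)"
    using assms by (auto simp: numerical_semigroup_def)
  have "atoms S \<noteq> {}"
  proof
    assume "atoms S = {}"
    then have "S = nat_submonoid hull {}" using hull_atoms[OF S(1)] by simp
    also have "\<dots> \<subseteq> {0}" by (rule hull_minimal) (auto simp: nat_submonoid_def)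
    finally have "finite S" using finite_subset by blast
    with S(2) show False using finite_Un[of S "- S"] by simp
  qed
  then show ?thesis
    using finite_atoms[OF assms] embedding_dim_eq_card_atoms[OF assms] by (simp add: card_gt_0_iff)
qed

section \<open>The extension of \<open>d * \<Delta>\<close> by all nonzero residues modulo
  \<open>d\<close>\<close>

text \<open>Once all numbers from \<open>N\<close> on lie in \<open>\<Delta>\<close>, this is the
  submonoid generated by \<open>d * \<Delta>\<close> and the numbers \<open>d * N + r\<close>. Each
  element is written with at most one new generator, so its residue modulo \<open>d\<close> decides
  which form it has.\<close>

definition residue_extension :: "nat set \<Rightarrow> nat \<Rightarrow> nat \<Rightarrow> nat set" where
  "residue_extension \<Delta> d N =
     (*) d ` \<Delta> \<union> {d * N + r + d * s | r s. 0 < r \<and> r < d \<and> s \<in> \<Delta>}"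

lemma residue_extension_cases:
  assumes "y \<in> residue_extension \<Delta> d N"
  obtains (dvd) x where "x \<in> \<Delta>" "y = d * x"
  | (not_dvd) r s where "0 < r" "r < d" "s \<in> \<Delta>" "y = d * N + r + d * s"
  using assms unfolding residue_extension_def by blast

lemma residue_extension_dvd: "x \<in> \<Delta> \<Longrightarrow> d * x \<in> residue_extension \<Delta> d N"
  by (auto simp: residue_extension_def)

lemma residue_extension_not_dvd:
  "0 < r \<Longrightarrow> r < d \<Longrightarrow> s \<in> \<Delta> \<Longrightarrow> d * N + r + d * s \<in> residue_extension \<Delta> d N"
  unfolding residue_extension_def by blast

lemma not_dvd_shift:
  fixes d :: nat
  assumes "0 < r" "r < d"
  shows "\<not> d dvd d * m + r + d * n"
proof -
  have "(d * m + r + d * n) mod d = r" using assms by simp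
  then show ?thesis using assms by (metis dvd_imp_mod_0 less_irrefl)
qed

context
  fixes \<Delta> :: "nat set" and d N :: nat
  assumes \<Delta>: "numerical_semigroup \<Delta>" and d: "d \<ge> 1"
    and N: "N \<ge> 1" "\<And>x. x \<ge> N \<Longrightarrow> x \<in> \<Delta>" "\<And>x. x \<in> atoms \<Delta> \<Longrightarrow> x < N"
begin

text \<open>The one case of closure in which two new generators meet. A surplus \<open>d * N\<close>
  moves into the multiple of \<open>d\<close>, whose cofactor is then at least \<open>N\<close> and
  hence in \<open>\<Delta>\<close>. The cases follow the carry of \<open>r + r'\<close> past
  \<open>d\<close>.\<close>

lemma residue_extension_add_not_dvd:
  assumes "0 < r" "r < d" "s \<in> \<Delta>" "0 < r'" "r' < d" "s' \<in> \<Delta>"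
  shows "(d * N + r + d * s) + (d * N + r' + d * s') \<in> residue_extension \<Delta> d N"
proof -
  consider "r + r' < d" | "r + r' = d" | "r + r' > d" by linarith
  then show ?thesis
  proof cases
    case 1
    have "d * N + (r + r') + d * (N + s + s') \<in> residue_extension \<Delta> d N"
      using 1 assms N(2)[of "N + s + s'"] by (intro residue_extension_not_dvd) auto
    then show ?thesis by (simp add: algebra_simps)
  next
    case 2
    have "d * (2 * N + 1 + s + s') \<in> residue_extension \<Delta> d N"
      using N(2)[of "2 * N + 1 + s + s'"] by (intro residue_extension_dvd) auto
    moreover have "d * (2 * N + 1 + s + s') = (d * N + r + d * s) + (d * N + r' + d * s')"
      using 2 by (simp add: algebra_simps)
    ultimately show ?thesis by metis
  next
    case 3
    then obtain t where t: "r + r' = d + t" "0 < t"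
      using that[of "r + r' - d"] by simp
    have "d * N + t + d * (N + 1 + s + s') \<in> residue_extension \<Delta> d N"
      using t assms N(2)[of "N + 1 + s + s'"] by (intro residue_extension_not_dvd) auto
    moreover have
      "d * N + t + d * (N + 1 + s + s') = (d * N + r + d * s) + (d * N + r' + d * s')"
      using t by (simp add: algebra_simps)
    ultimately show ?thesis by metis
  qed
qed

lemma numerical_semigroup_residue_extension:
  "numerical_semigroup (residue_extension \<Delta> d N)"
  unfolding numerical_semigroup_def nat_submonoid_def
proof (intro conjI ballI)
  show "0 \<in> residue_extension \<Delta> d N"
    using residue_extension_dvd[OF numerical_semigroup_zero[OF \<Delta>], of d N] by simp
next
  have mixed: "d * x + (d * N + r + d * s) \<in> residue_extension \<Delta> d N"
    if "x \<in> \<Delta>" "0 < r" "r < d" "s \<in> \<Delta>" for x r s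
    using residue_extension_not_dvd[OF that(2,3) numerical_semigroup_add[OF \<Delta> that(1,4)], of N]
    by (simp add: algebra_simps)
  fix a b
  assume a: "a \<in> residue_extension \<Delta> d N" and b: "b \<in> residue_extension \<Delta> d N"
  from a show "a + b \<in> residue_extension \<Delta> d N"
  proof (cases rule: residue_extension_cases)
    case a: (dvd x)
    from b show ?thesis
    proof (cases rule: residue_extension_cases)
      case (dvd y)
      then show ?thesis
        using residue_extension_dvd[OF numerical_semigroup_add[OF \<Delta> a(1)], of y d N] a
        by (simp add: algebra_simps)
    next
      case (not_dvd r s)
      then show ?thesis using mixed a by simp
    qed
  next
    case a: (not_dvd r s)
    from b show ?thesis
    proof (cases rule: residue_extension_cases)
      case (dvd y)
      then show ?thesis using mixed[of y r s] a by (simp add: add.commute)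
    next
      case (not_dvd r' s')
      then show ?thesis using residue_extension_add_not_dvd[of r s r' s'] a by simp
    qed
  qed
next
  \<comment> \<open>With \<open>y div d\<close> at least \<open>2 * N\<close>, one \<open>N\<close>
    pays for the new generator and the other puts the remaining cofactor into
    \<open>\<Delta>\<close>.\<close>
  have "y \<in> residue_extension \<Delta> d N" if "2 * N * d \<le> y" for y
  proof -
    have q: "2 * N \<le> y div d" using that d by (simp add: less_eq_div_iff_mult_less_eq)
    show ?thesis
    proof (cases "y mod d = 0")
      case True
      then have "y = d * (y div d)" by auto
      moreover have "y div d \<in> \<Delta>" using q by (intro N(2)) simp
      ultimately show ?thesis using residue_extension_dvd by metis
    next
      case False
      obtain s where s: "y div d = N + s" "N \<le> s"
        using q that[of "y div d - N"] le_Suc_ex[of N "y div d"] by auto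
      have "y = d * (y div d) + y mod d" by simp
      also have "\<dots> = d * N + y mod d + d * s" unfolding s(1) by (simp add: algebra_simps)
      also have "\<dots> \<in> residue_extension \<Delta> d N"
        using False d s(2) N(2) by (intro residue_extension_not_dvd) auto
      finally show ?thesis .
    qed
  qed
  then have "- residue_extension \<Delta> d N \<subseteq> {..<2 * N * d}" by (auto simp: not_less[symmetric])
  then show "finite (- residue_extension \<Delta> d N)" using finite_subset by blast
qed

text \<open>Elements that involve a new generator have nonzero residue modulo \<open>d\<close>, so
  only \<open>d * \<Delta>\<close> contributes, and \<open>d\<close> cancels.\<close>

lemma set_quotient_residue_extension: "set_quotient (residue_extension \<Delta> d N) d = \<Delta>"
proof -
  have "d * x \<in> residue_extension \<Delta> d N \<longleftrightarrow> x \<in> \<Delta>" for x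
  proof
    assume "d * x \<in> residue_extension \<Delta> d N"
    then show "x \<in> \<Delta>"
    proof (cases rule: residue_extension_cases)
      case (dvd y)
      then show ?thesis using d by simp
    next
      case (not_dvd r s)
      then show ?thesis using not_dvd_shift[of r d N s] dvd_triv_left[of d x] by simp
    qed
  qed (rule residue_extension_dvd)
  then show ?thesis by (simp add: set_quotient_def)
qed

section \<open>The atoms of the extension\<close>

text \<open>Since \<open>x < N\<close>, both summands of \<open>d * x\<close> are at most
  \<open>d * N\<close>, too small to contain a new generator. So both lie in
  \<open>d * \<Delta>\<close>, and dividing by \<open>d\<close> would decompose
  \<open>x\<close>.\<close>

lemma dvd_atoms_residue_extension:
  assumes "x \<in> atoms \<Delta>"
  shows "d * x \<in> atoms (residue_extension \<Delta> d N)"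
proof -
  have x: "x \<in> \<Delta>" "x \<noteq> 0" "x < N" using assms N(3) by (auto simp: atoms_def)
  have "False" if ab: "a \<in> residue_extension \<Delta> d N" "b \<in> residue_extension \<Delta> d N"
    "a \<noteq> 0" "b \<noteq> 0" "d * x = a + b" for a b
  proof -
    have "d * x \<le> d * N" using x by simp
    then have small: "a \<le> d * N" "b \<le> d * N" using ab(5) by linarith+
    from ab(1) small obtain u where u: "u \<in> \<Delta>" "a = d * u"
      by (cases rule: residue_extension_cases) auto
    from ab(2) small obtain v where v: "v \<in> \<Delta>" "b = d * v"
      by (cases rule: residue_extension_cases) auto
    have "d * x = d * (u + v)" using ab(5) u v by (simp add: algebra_simps)
    then have "x = u + v" using d by simp
    moreover have "u \<noteq> 0" "v \<noteq> 0" using ab u v by auto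
    ultimately show False using assms u v by (auto simp: atoms_def)
  qed
  then show ?thesis using x d residue_extension_dvd by (auto simp: atoms_def)
qed

text \<open>Two multiples of \<open>d\<close> cannot sum to a nonzero residue, and two elements with
  new generators exceed \<open>2 * d * N\<close>, which is too large. Only the mixed decomposition
  needs a comparison of residues.\<close>

lemma not_dvd_atoms_residue_extension:
  assumes r: "0 < r" "r < d"
  shows "d * N + r \<in> atoms (residue_extension \<Delta> d N)"
proof -
  have mixed: "False" if "d * N + r = d * x + (d * N + r' + d * s)" "d * x \<noteq> 0" "0 < r'" "r' < d"
    for x r' s
  proof -
    \<comment> \<open>Both \<open>r\<close> and \<open>r'\<close> are below \<open>d\<close>, so
      congruence forces \<open>r = r'\<close> and then \<open>d * x = 0\<close>.\<close>
    have eq: "r = r' + d * (x + s)" using that(1) by (simp add: algebra_simps)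
    then have "r mod d = r' mod d" by simp
    with eq r that show False by simp
  qed
  have "False" if ab: "a \<in> residue_extension \<Delta> d N" "b \<in> residue_extension \<Delta> d N"
    "a \<noteq> 0" "b \<noteq> 0" "d * N + r = a + b" for a b
    using ab(1)
  proof (cases rule: residue_extension_cases)
    case a: (dvd x)
    from ab(2) show False
    proof (cases rule: residue_extension_cases)
      case (dvd y)
      have "d dvd a + b" using a dvd by simp
      then show False using not_dvd_shift[of r d N 0] r ab(5) by simp
    next
      case (not_dvd r' s)
      then show False using mixed[of x r' s] a ab by simp
    qed
  next
    case a: (not_dvd r' s)
    from ab(2) show False
    proof (cases rule: residue_extension_cases)
      case (dvd y)
      then show False using mixed[of y r' s] a ab by simp
    next
      case (not_dvd r'' s')
      \<comment> \<open>This gives \<open>d * N + r < d * N + d \<le> 2 * d * N\<close>,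
        contradicting the size of the sum.\<close>
      have "d \<le> d * N" using N(1) by simp
      then show False using a not_dvd ab(5) r by linarith
    qed
  qed
  then show ?thesis
    using r residue_extension_not_dvd[OF r numerical_semigroup_zero[OF \<Delta>], of N]
    by (auto simp: atoms_def)
qed

lemma atoms_residue_extension:
  "atoms (residue_extension \<Delta> d N) = (*) d ` atoms \<Delta> \<union> (+) (d * N) ` {0<..<d}"
proof
  show "(*) d ` atoms \<Delta> \<union> (+) (d * N) ` {0<..<d} \<subseteq> atoms (residue_extension \<Delta> d N)"
    using dvd_atoms_residue_extension not_dvd_atoms_residue_extension by auto
  show "atoms (residue_extension \<Delta> d N) \<subseteq> (*) d ` atoms \<Delta> \<union> (+) (d * N) ` {0<..<d}"
  proof
    fix y assume y: "y \<in> atoms (residue_extension \<Delta> d N)"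
    then have y': "y \<noteq> 0"
      and irred: "\<And>a b. a \<in> residue_extension \<Delta> d N \<Longrightarrow> b \<in> residue_extension \<Delta> d N \<Longrightarrow>
        a \<noteq> 0 \<Longrightarrow> b \<noteq> 0 \<Longrightarrow> y \<noteq> a + b"
      by (auto simp: atoms_def)
    from y have "y \<in> residue_extension \<Delta> d N" by (simp add: atoms_def)
    then show "y \<in> (*) d ` atoms \<Delta> \<union> (+) (d * N) ` {0<..<d}"
    proof (cases rule: residue_extension_cases)
      case (dvd x)
      \<comment> \<open>A decomposition of \<open>x\<close> in \<open>\<Delta>\<close> would scale
        by \<open>d\<close> to one of \<open>y\<close>.\<close>
      have "x \<noteq> u + v" if "u \<in> \<Delta>" "v \<in> \<Delta>" "u \<noteq> 0" "v \<noteq> 0" for u v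
        using irred[OF residue_extension_dvd[OF that(1)] residue_extension_dvd[OF that(2)]]
          that d dvd by (auto simp: algebra_simps)
      then have "x \<in> atoms \<Delta>" using dvd y' by (auto simp: atoms_def)
      then show ?thesis using dvd by blast
    next
      case (not_dvd r s)
      \<comment> \<open>Otherwise \<open>y\<close> splits as the new generator
        \<open>d * N + r\<close> plus \<open>d * s\<close>.\<close>
      have "s = 0"
        using irred[OF residue_extension_not_dvd[OF not_dvd(1,2) numerical_semigroup_zero[OF \<Delta>]]
            residue_extension_dvd[OF not_dvd(3)]] not_dvd d by auto
      then show ?thesis using not_dvd by auto
    qed
  qed
qed

lemma embedding_dim_residue_extension:
  "embedding_dim (residue_extension \<Delta> d N) = embedding_dim \<Delta> + (d - 1)"
proof -
  have "(*) d ` atoms \<Delta> \<inter> (+) (d * N) ` {0<..<d} = {}"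
    using not_dvd_shift[of _ d N 0] by (fastforce simp: dvd_def dest: sym)
  moreover have "inj_on ((*) d) (atoms \<Delta>)" using d by (auto simp: inj_on_def)
  ultimately show ?thesis
    using finite_atoms[OF \<Delta>]
    by (simp add: embedding_dim_eq_card_atoms \<Delta> numerical_semigroup_residue_extension
        atoms_residue_extension card_Un_disjoint card_image)
qed

end

section \<open>Realizing prescribed embedding dimensions\<close>

lemma ex_quotient_embedding_dim:
  assumes \<Delta>: "numerical_semigroup \<Delta>" and d: "d \<ge> 1"
  shows "\<exists>S. numerical_semigroup S \<and> set_quotient S d = \<Delta> \<and>
    embedding_dim S = embedding_dim \<Delta> + (d - 1)"
proof -
  have "finite (- \<Delta> \<union> atoms \<Delta>)"
    using \<Delta> finite_atoms by (auto simp: numerical_semigroup_def)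
  then obtain c where c: "\<And>x. x \<in> - \<Delta> \<union> atoms \<Delta> \<Longrightarrow> x < c"
    using finite_nat_set_iff_bounded by auto
  \<comment> \<open>Taking \<open>Suc c\<close> instead of \<open>c\<close> makes the bound
    \<open>N \<ge> 1\<close> immediate.\<close>
  have N: "Suc c \<ge> 1" "\<And>x. x \<ge> Suc c \<Longrightarrow> x \<in> \<Delta>" "\<And>x. x \<in> atoms \<Delta> \<Longrightarrow> x < Suc c"
    using c by fastforce+
  show ?thesis
    using numerical_semigroup_residue_extension[OF \<Delta> d N]
      set_quotient_residue_extension[OF \<Delta> d N] embedding_dim_residue_extension[OF \<Delta> d N]
    by blast
qed

lemma set_quotient_set_quotient:
  "set_quotient (set_quotient A m) n = set_quotient A (m * n)"
  by (simp add: set_quotient_def mult.assoc)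

theorem corollary3p3:
  fixes \<Delta> :: "nat set"
  assumes "numerical_semigroup \<Delta>"
  shows "(\<forall>k\<ge>embedding_dim \<Delta>.
            (\<exists>d\<ge>1. \<exists>S. numerical_semigroup S \<and> set_quotient S d = \<Delta> \<and> embedding_dim S = k)
          \<and> (let d = k - (embedding_dim \<Delta> - 1) in
               d \<ge> 1 \<and> (\<exists>S. numerical_semigroup S \<and> set_quotient S d = \<Delta> \<and> embedding_dim S = k)))
       \<and> (\<forall>k\<ge>min_embedding_dim_multiples \<Delta>. \<exists>T. is_multiple_of T \<Delta> \<and> embedding_dim T = k)"
proof (intro conjI allI impI)
  \<comment> \<open>Stated for arbitrary \<open>T\<close>, since the second claim applies it to a
    multiple of \<open>\<Delta>\<close> instead of \<open>\<Delta>\<close> itself.\<close>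
  have ex: "d \<ge> 1 \<and> (\<exists>S. numerical_semigroup S \<and> set_quotient S d = T \<and> embedding_dim S = k)"
    if T: "numerical_semigroup T" and k: "k \<ge> embedding_dim T"
      and d: "d = k - (embedding_dim T - 1)" for T k d
  proof -
    have "d \<ge> 1" "embedding_dim T + (d - 1) = k" using embedding_dim_pos[OF T] k d by linarith+
    then show ?thesis using ex_quotient_embedding_dim[OF T, of d] by simp
  qed
  fix k
  {
    assume k: "k \<ge> embedding_dim \<Delta>"
    show "\<exists>d\<ge>1. \<exists>S. numerical_semigroup S \<and> set_quotient S d = \<Delta> \<and> embedding_dim S = k"
      using ex[OF assms k refl] by blast
    show "let d = k - (embedding_dim \<Delta> - 1) in
      d \<ge> 1 \<and> (\<exists>S. numerical_semigroup S \<and> set_quotient S d = \<Delta> \<and> embedding_dim S = k)"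
      unfolding Let_def by (rule ex[OF assms k refl])
  next
    assume k: "k \<ge> min_embedding_dim_multiples \<Delta>"
    \<comment> \<open>With divisor 1, \<open>\<Delta>\<close> is a multiple of itself; hence the
      least embedding dimension is attained.\<close>
    have "is_multiple_of \<Delta> \<Delta>"
      using assms by (auto simp: is_multiple_of_def set_quotient_def intro!: exI[of _ 1])
    then have "\<exists>e T. is_multiple_of T \<Delta> \<and> e = embedding_dim T" by blast
    then have "\<exists>T. is_multiple_of T \<Delta> \<and> min_embedding_dim_multiples \<Delta> = embedding_dim T"
      unfolding min_embedding_dim_multiples_def by (rule LeastI_ex)
    then obtain T m where T: "numerical_semigroup T" "embedding_dim T \<le> k"
      and m: "m \<ge> 1" "set_quotient T m = \<Delta>"
      using k by (auto simp: is_multiple_of_def)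
    obtain d S where d: "d \<ge> 1" and S: "numerical_semigroup S" "set_quotient S d = T"
      "embedding_dim S = k"
      using ex[OF T refl] by blast
    \<comment> \<open>Quotients compose: dividing \<open>S\<close> by \<open>d\<close> gives
      \<open>T\<close>, and dividing \<open>T\<close> by \<open>m\<close> gives
      \<open>\<Delta>\<close>.\<close>
    have "set_quotient S (d * m) = \<Delta>" "d * m \<ge> 1"
      using S m d by (simp_all flip: set_quotient_set_quotient)
    then show "\<exists>T. is_multiple_of T \<Delta> \<and> embedding_dim T = k"
      using S assms unfolding is_multiple_of_def by blast
  }
qed

end
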